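(* Let $q\in(1,\infty)$. The $q$-root transform $$\Phi_q:\Delta^q\longrightarrow\mathcal{U}_q,\qquad(p_n)\longmapsto\big(p_n^{1/q}\big),$$ is an isometry between $(\Delta^q,\mathcal{F}^q)$ and $(\mathcal{U}_q,\|\cdot\|_{\ell^q})$.
   Context: $\ell^q_{\mathbb{R}}$ is the space of real sequences $(x_n)_{n\in\mathbb{N}}$ (indices start at $0$) with $\|(x_n)\|_{\ell^q}:=(\sum_{n=0}^\infty|x_n|^q)^{1/q}<\infty$, and $\mathbb{S}(\ell^q_{\mathbb{R}})$ is its unit sphere. $\mathcal{U}_q:=\{(x_n)\in\mathbb{S}(\ell^q_{\mathbb{R}}):x_n>0\ \forall n\in\mathbb{N}\}$, regarded as an open subset of the sphere, with the Finsler structure given by $\|\cdot\|_{\ell^q}$ on tangent vectors. $\Delta^q$ denotes the set $\Delta:=\{(p_n)\in\ell^1_{\mathbb{R}}:\sum_{n=0}^\infty p_n=1,\ p_n>0\ \forall n\in\mathbb{N}\}$ equipped with the differentiable structure for which the homeomorphism $\Phi_q:\Delta\to\mathcal{U}_q$, $(p_n)\mapsto(p_n^{1/q})$, becomes a diffeomorphism (for $q=2$ this is the set $\Delta$ with the differentiable structure defined by the square-root map). Its tangent spaces are $$T_{(p_n)}\Delta^q=\Big\{(v_n)\in\ell^1_{\mathbb{R}}:\sum_{n=0}^\infty v_n=0\ \text{and}\ \big(v_n\,p_n^{1/q-1}\big)\in\ell^q_{\mathbb{R}}\Big\}.$$ The $\ell^q$-Fisher--Rao metric is the Finsler metric $$\mathcal{F}^q_{(p_n)}((v_n)):=\Big(\sum_{n=0}^\infty\Big|\frac{v_n}{p_n}\Big|^q\cdot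 p_n\Big)^{1/q},\qquad ((p_n),(v_n))\in T\Delta^q.$$
   Formalization: The norm on the target is multiplied by q: the differential of the q-root transform has norm 1/q times the Fisher–Rao norm, so the isometry as stated fails for every q > 1. Smoothness is C¹, and tangent vectors of U_q are velocities of curves in the sphere, since U_q is not open in it. *)

theory Defs
  imports Complex_Main
begin

section \<open>The spaces of \<open>q\<close>-summable real sequences\<close>

definition lq :: "real \<Rightarrow> (nat \<Rightarrow> real) set" where
  "lq q = {x. summable (\<lambda>n. \<bar>x n\<bar> powr q)}"

definition lq_norm :: "real \<Rightarrow> (nat \<Rightarrow> real) \<Rightarrow> real" where
  "lq_norm q x = (\<Sum>n. \<bar>x n\<bar> powr q) powr (1 / q)"

definition lq_sphere :: "real \<Rightarrow> (nat \<Rightarrow> real) set" where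
  "lq_sphere q = {x \<in> lq q. lq_norm q x = 1}"

definition lq_open :: "real \<Rightarrow> (nat \<Rightarrow> real) set \<Rightarrow> bool" where
  "lq_open q A \<longleftrightarrow> A \<subseteq> lq q \<and>
     (\<forall>x\<in>A. \<exists>e>0. \<forall>y\<in>lq q. lq_norm q (\<lambda>n. y n - x n) < e \<longrightarrow> y \<in> A)"

definition lq_has_velocity ::
    "real \<Rightarrow> (real \<Rightarrow> nat \<Rightarrow> real) \<Rightarrow> (nat \<Rightarrow> real) \<Rightarrow> real \<Rightarrow> bool" where
  "lq_has_velocity q c v t \<longleftrightarrow> (\<forall>s. c s \<in> lq q) \<and> v \<in> lq q \<and>
     ((\<lambda>h. lq_norm q (\<lambda>n. (c (t + h) n - c t n) / h - v n)) \<longlongrightarrow> 0) (at 0)"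

definition lq_C1_curve :: "real \<Rightarrow> (real \<Rightarrow> nat \<Rightarrow> real) \<Rightarrow> bool" where
  "lq_C1_curve q c \<longleftrightarrow>
     (\<exists>c'. (\<forall>t. lq_has_velocity q c (c' t) t) \<and>
           (\<forall>t. ((\<lambda>s. lq_norm q (\<lambda>n. c' s n - c' t n)) \<longlongrightarrow> 0) (at t)))"

definition lq_bounded_linear :: "real \<Rightarrow> ((nat \<Rightarrow> real) \<Rightarrow> nat \<Rightarrow> real) \<Rightarrow> bool" where
  "lq_bounded_linear q L \<longleftrightarrow>
     (\<forall>x\<in>lq q. L x \<in> lq q) \<and>
     (\<forall>x\<in>lq q. \<forall>y\<in>lq q. \<forall>a b.
        L (\<lambda>n. a * x n + b * y n) = (\<lambda>n. a * L x n + b * L y n)) \<and>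
     (\<exists>K. \<forall>x\<in>lq q. lq_norm q (L x) \<le> K * lq_norm q x)"

definition lq_frechet ::
    "real \<Rightarrow> ((nat \<Rightarrow> real) \<Rightarrow> nat \<Rightarrow> real) \<Rightarrow> ((nat \<Rightarrow> real) \<Rightarrow> nat \<Rightarrow> real)
      \<Rightarrow> (nat \<Rightarrow> real) \<Rightarrow> bool" where
  "lq_frechet q G L x \<longleftrightarrow> lq_bounded_linear q L \<and>
     (\<forall>e>0. \<exists>d>0. \<forall>y\<in>lq q. lq_norm q (\<lambda>n. y n - x n) < d \<longrightarrow>
        lq_norm q (\<lambda>n. G y n - G x n - L (\<lambda>k. y k - x k) n)
          \<le> e * lq_norm q (\<lambda>n. y n - x n))"

definition lq_C1_open ::
    "real \<Rightarrow> ((nat \<Rightarrow> real) \<Rightarrow> nat \<Rightarrow> real) \<Rightarrow> (nat \<Rightarrow> real) set \<Rightarrow> bool" where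
  "lq_C1_open q G A \<longleftrightarrow> lq_open q A \<and> (\<forall>x\<in>A. G x \<in> lq q) \<and>
     (\<exists>G'. \<forall>x\<in>A. lq_frechet q G (G' x) x \<and>
        (\<forall>e>0. \<exists>d>0. \<forall>y\<in>A. lq_norm q (\<lambda>n. y n - x n) < d \<longrightarrow>
           (\<forall>z\<in>lq q. lq_norm q (\<lambda>n. G' y z n - G' x z n) \<le> e * lq_norm q z)))"

text \<open>A map on an arbitrary subset of the sequence space is \<open>C\<^sup>1\<close> if locally it extends
  to a \<open>C\<^sup>1\<close> map on an open set.\<close>

definition lq_C1_on ::
    "real \<Rightarrow> ((nat \<Rightarrow> real) \<Rightarrow> nat \<Rightarrow> real) \<Rightarrow> (nat \<Rightarrow> real) set \<Rightarrow> bool" where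
  "lq_C1_on q g X \<longleftrightarrow>
     (\<forall>x\<in>X. \<exists>A G. x \<in> A \<and> lq_C1_open q G A \<and> (\<forall>y\<in>A \<inter> X. G y = g y))"


section \<open>Finsler spaces of sequences and their isometries\<close>

text \<open>The differentiable structure on \<open>points M\<close> is the one pulled back along the injective
  map \<open>chart M\<close> from its image, a subset of the model space \<open>lq q\<close>. The differentiability class
  is \<open>C\<^sup>1\<close>, since for \<open>1 < q < 2\<close> the norm of \<open>lq q\<close> is not \<open>C\<^sup>2\<close>. Tangent vectors are again sequences: \<open>v\<close> is tangent to a curve if it is
  the derivative of the curve in the norm of \<open>lq (ambient M)\<close>. \<open>tangent M p\<close> is the tangent space
  at \<open>p\<close>, and \<open>fnorm M p v\<close> the Finsler length of \<open>v\<close> in \<open>tangent M p\<close>.\<close>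

record finsler_space =
  points :: "(nat \<Rightarrow> real) set"
  chart :: "(nat \<Rightarrow> real) \<Rightarrow> nat \<Rightarrow> real"
  ambient :: real
  tangent :: "(nat \<Rightarrow> real) \<Rightarrow> (nat \<Rightarrow> real) set"
  fnorm :: "(nat \<Rightarrow> real) \<Rightarrow> (nat \<Rightarrow> real) \<Rightarrow> real"

definition C1_map ::
    "real \<Rightarrow> finsler_space \<Rightarrow> finsler_space \<Rightarrow> ((nat \<Rightarrow> real) \<Rightarrow> nat \<Rightarrow> real) \<Rightarrow> bool" where
  "C1_map q M N f \<longleftrightarrow> f ` points M \<subseteq> points N \<and>
     lq_C1_on q (chart N \<circ> f \<circ> inv_into (points M) (chart M)) (chart M ` points M)"

definition diffeomorphism ::
    "real \<Rightarrow> finsler_space \<Rightarrow> finsler_space \<Rightarrow> ((nat \<Rightarrow> real) \<Rightarrow> nat \<Rightarrow> real) \<Rightarrow> bool" where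
  "diffeomorphism q M N f \<longleftrightarrow> bij_betw f (points M) (points N) \<and>
     C1_map q M N f \<and> C1_map q N M (inv_into (points M) f)"

text \<open>\<open>curve_through q M c p v\<close>: \<open>c\<close> is a \<open>C\<^sup>1\<close> curve in \<open>M\<close> with position \<open>p\<close> and velocity
  \<open>v\<close> at time \<open>0\<close>.\<close>

definition curve_through ::
    "real \<Rightarrow> finsler_space \<Rightarrow> (real \<Rightarrow> nat \<Rightarrow> real) \<Rightarrow> (nat \<Rightarrow> real) \<Rightarrow> (nat \<Rightarrow> real) \<Rightarrow> bool" where
  "curve_through q M c p v \<longleftrightarrow> (\<forall>t. c t \<in> points M) \<and> lq_C1_curve q (chart M \<circ> c) \<and>
     c 0 = p \<and> lq_has_velocity (ambient M) c v 0"

text \<open>The existence of a curve with velocity \<open>v\<close>, for each tangent vector \<open>v\<close>, makes the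
  differential \<open>L\<close> unique on \<open>tangent M p\<close>.\<close>

definition has_differential ::
    "real \<Rightarrow> finsler_space \<Rightarrow> finsler_space \<Rightarrow> ((nat \<Rightarrow> real) \<Rightarrow> nat \<Rightarrow> real)
      \<Rightarrow> (nat \<Rightarrow> real) \<Rightarrow> ((nat \<Rightarrow> real) \<Rightarrow> nat \<Rightarrow> real) \<Rightarrow> bool" where
  "has_differential q M N f p L \<longleftrightarrow>
     (\<forall>v\<in>tangent M p. \<forall>w\<in>tangent M p. \<forall>a b.
        L (\<lambda>n. a * v n + b * w n) = (\<lambda>n. a * L v n + b * L w n)) \<and>
     (\<forall>v\<in>tangent M p. L v \<in> tangent N (f p) \<and>
        (\<exists>c. curve_through q M c p v) \<and>
        (\<forall>c. curve_through q M c p v \<longrightarrow> curve_through q N (f \<circ> c) (f p) (L v)))"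

definition finsler_isometry ::
    "real \<Rightarrow> finsler_space \<Rightarrow> finsler_space \<Rightarrow> ((nat \<Rightarrow> real) \<Rightarrow> nat \<Rightarrow> real) \<Rightarrow> bool" where
  "finsler_isometry q M N f \<longleftrightarrow> diffeomorphism q M N f \<and>
     (\<forall>p\<in>points M. \<exists>L. has_differential q M N f p L \<and>
        bij_betw L (tangent M p) (tangent N (f p)) \<and>
        (\<forall>v\<in>tangent M p. fnorm N (f p) (L v) = fnorm M p v))"

text \<open>The differential of \<open>p \<mapsto> p powr (1/q)\<close> is \<open>v \<mapsto> (1/q) * v * p powr (1/q - 1)\<close>, so that the norm
  of its value is \<open>1/q\<close> times the Fisher--Rao norm of \<open>v\<close> defined below. The root transform is
  therefore an isometry only after multiplying the norm on the sphere by \<open>q\<close>.\<close>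

definition rescale :: "real \<Rightarrow> finsler_space \<Rightarrow> finsler_space" where
  "rescale k M = M\<lparr>fnorm := \<lambda>p v. k * fnorm M p v\<rparr>"


section \<open>The simplex, the positive part of the sphere, and the root transform\<close>

definition root_transform :: "real \<Rightarrow> (nat \<Rightarrow> real) \<Rightarrow> nat \<Rightarrow> real" where
  "root_transform q p = (\<lambda>n. p n powr (1 / q))"

definition simplex :: "(nat \<Rightarrow> real) set" where
  "simplex = {p \<in> lq 1. (\<Sum>n. p n) = 1 \<and> (\<forall>n. p n > 0)}"

definition simplex_tangent :: "real \<Rightarrow> (nat \<Rightarrow> real) \<Rightarrow> (nat \<Rightarrow> real) set" where
  "simplex_tangent q p =
     {v \<in> lq 1. (\<Sum>n. v n) = 0 \<and> (\<lambda>n. v n * p n powr (1 / q - 1)) \<in> lq q}"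

definition fisher_rao :: "real \<Rightarrow> (nat \<Rightarrow> real) \<Rightarrow> (nat \<Rightarrow> real) \<Rightarrow> real" where
  "fisher_rao q p v = (\<Sum>n. \<bar>v n / p n\<bar> powr q * p n) powr (1 / q)"

definition Delta :: "real \<Rightarrow> finsler_space" where
  "Delta q = \<lparr>points = simplex, chart = root_transform q, ambient = 1,
     tangent = simplex_tangent q, fnorm = fisher_rao q\<rparr>"

text \<open>As for an open subset of the sphere, tangent vectors are the velocities of curves in the
  whole sphere. (For the \<open>lq q\<close> topology the set of positive sequences has empty interior in
  the sphere, so nothing below relies on it being open.)\<close>

definition sphere_tangent :: "real \<Rightarrow> (nat \<Rightarrow> real) \<Rightarrow> (nat \<Rightarrow> real) set" where
  "sphere_tangent q x =
     {w. \<exists>c. (\<forall>t. c t \<in> lq_sphere q) \<and> lq_C1_curve q c \<and> c 0 = x \<and> lq_has_velocity q c w 0}"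

definition positive_sphere :: "real \<Rightarrow> finsler_space" where
  "positive_sphere q = \<lparr>points = {x \<in> lq_sphere q. \<forall>n. x n > 0}, chart = (\<lambda>x. x), ambient = q,
     tangent = sphere_tangent q, fnorm = (\<lambda>x w. lq_norm q w)\<rparr>"

end

theory Submission imports Defs "HOL-Analysis.Derivative" begin

text \<open>
  The root transform is its own chart, so it and its inverse are the identity in charts. The
  substance lies in the tangent spaces. If \<open>c\<close> is a curve in the sphere with \<open>c 0 = x\<close> positive, the
  tangent-line inequality \<open>q * x powr (q - 1) * y \<le> \<bar>y\<bar> powr q + (q - 1) * x powr q\<close>, summed over the
  coordinates, shows that \<open>\<Sum>n. x n powr (q - 1) * c t n\<close> is maximal at \<open>t = 0\<close>; hence every tangent
  vector \<open>w\<close> of the sphere satisfies \<open>(\<Sum>n. x n powr (q - 1) * w n) = 0\<close>, which is the condition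
  \<open>(\<Sum>n. v n) = 0\<close> for the corresponding \<open>v\<close>. Conversely, a tangent vector \<open>v\<close> at \<open>p\<close> is the velocity
  of the curve \<open>p n * bump (t * a n) powr q / S t\<close>, where \<open>a n = v n / (q * p n)\<close> and \<open>S t\<close> normalises
  the sum to \<open>1\<close>; since \<open>bump\<close> and its derivative are bounded, dominated convergence makes this
  curve and its root \<open>C\<^sup>1\<close>.
\<close>

section \<open>Linear structure and norm of the sequence spaces\<close>

lemma lq_comparison:
  assumes "summable g" "\<And>n. \<bar>x n\<bar> powr r \<le> g n"
  shows "x \<in> lq r"
  unfolding lq_def using assms
  by (intro CollectI summable_comparison_test'[of g 0 "\<lambda>n. \<bar>x n\<bar> powr r"]) simp_all

lemma lq_dominated:
  assumes "y \<in> lq r" "0 < r" "\<And>n. \<bar>x n\<bar> \<le> C * \<bar>y n\<bar>"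
  shows "x \<in> lq r"
proof -
  have "\<bar>x n\<bar> powr r \<le> \<bar>C\<bar> powr r * \<bar>y n\<bar> powr r" for n
  proof -
    have "\<bar>x n\<bar> \<le> \<bar>C\<bar> * \<bar>y n\<bar>"
      using assms(3)[of n] by (meson abs_ge_self abs_ge_zero mult_right_mono order_trans)
    then have "\<bar>x n\<bar> powr r \<le> (\<bar>C\<bar> * \<bar>y n\<bar>) powr r"
      using assms(2) by (intro powr_mono2) auto
    then show ?thesis by (simp add: powr_mult)
  qed
  moreover have "summable (\<lambda>n. \<bar>C\<bar> powr r * \<bar>y n\<bar> powr r)"
    using assms(1) by (simp add: lq_def summable_mult)
  ultimately show ?thesis
    by (rule lq_comparison[rotated])
qed

lemma lq_add:
  assumes "x \<in> lq r" "y \<in> lq r" "0 < r"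
  shows "(\<lambda>n. x n + y n) \<in> lq r"
proof -
  \<comment> \<open>Twice the maximum replaces a convexity argument, which would fail for
    \<open>r < 1\<close>.\<close>
  have "\<bar>x n + y n\<bar> powr r \<le> 2 powr r * (\<bar>x n\<bar> powr r + \<bar>y n\<bar> powr r)" for n
  proof -
    have "\<bar>x n + y n\<bar> powr r \<le> (2 * max \<bar>x n\<bar> \<bar>y n\<bar>) powr r"
      using assms(3) by (intro powr_mono2) auto
    also have "\<dots> = 2 powr r * max \<bar>x n\<bar> \<bar>y n\<bar> powr r"
      by (simp add: powr_mult)
    also have "\<dots> \<le> 2 powr r * (\<bar>x n\<bar> powr r + \<bar>y n\<bar> powr r)"
      by (intro mult_left_mono) (auto simp: max_def)
    finally show ?thesis .
  qed
  moreover have "summable (\<lambda>n. 2 powr r * (\<bar>x n\<bar> powr r + \<bar>y n\<bar> powr r))"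
    using assms(1,2) by (simp add: lq_def summable_mult summable_add)
  ultimately show ?thesis
    by (rule lq_comparison[rotated])
qed

lemma lq_scale:
  assumes "x \<in> lq r" "0 < r"
  shows "(\<lambda>n. k * x n) \<in> lq r"
  using lq_dominated[OF assms, of "\<lambda>n. k * x n" "\<bar>k\<bar>"] by (simp add: abs_mult)

lemma lq_diff:
  assumes "x \<in> lq r" "y \<in> lq r" "0 < r"
  shows "(\<lambda>n. x n - y n) \<in> lq r"
  using lq_add[OF assms(1) lq_scale[OF assms(2,3), of "-1"] assms(3)] by simp

lemma lq_abs: "(\<lambda>n. \<bar>x n\<bar>) \<in> lq r \<longleftrightarrow> x \<in> lq r"
  by (simp add: lq_def)

lemma lq_1_iff: "x \<in> lq 1 \<longleftrightarrow> summable (\<lambda>n. \<bar>x n\<bar>)"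
  by (simp add: lq_def)

lemma lq_norm_powr:
  assumes "0 < r" "x \<in> lq r"
  shows "lq_norm r x powr r = (\<Sum>n. \<bar>x n\<bar> powr r)"
  using assms by (simp add: lq_norm_def lq_def powr_powr suminf_nonneg)

lemma abs_le_lq_norm:
  assumes "0 < r" "x \<in> lq r"
  shows "\<bar>x n\<bar> \<le> lq_norm r x"
proof -
  have "\<bar>x n\<bar> powr r \<le> (\<Sum>n. \<bar>x n\<bar> powr r)"
    using sum_le_suminf[of "\<lambda>n. \<bar>x n\<bar> powr r" "{n}"] assms(2) by (simp add: lq_def)
  then have "(\<bar>x n\<bar> powr r) powr (1 / r) \<le> (\<Sum>n. \<bar>x n\<bar> powr r) powr (1 / r)"
    using assms(1) by (intro powr_mono2) auto
  then show ?thesis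
    using assms(1) by (simp add: powr_powr lq_norm_def)
qed

section \<open>Dominated convergence and differentiation of curves\<close>

text \<open>Dominated convergence for series (Tannery's theorem), applied to the \<open>r\<close>-th
  powers of the coordinates with majorant \<open>\<bar>B n\<bar> powr r\<close>.\<close>

lemma lq_norm_tendsto_0:
  assumes r: "0 < r" and B: "B \<in> lq r" and F: "F \<noteq> bot"
    and bound: "eventually (\<lambda>h. \<forall>n. \<bar>z h n\<bar> \<le> B n) F"
    and lim: "\<And>n. ((\<lambda>h. z h n) \<longlongrightarrow> 0) F"
  shows "((\<lambda>h. lq_norm r (z h)) \<longlongrightarrow> 0) F"
proof -
  have "((\<lambda>h. \<Sum>n. \<bar>z h n\<bar> powr r) \<longlongrightarrow> (\<Sum>n. 0)) F"
  proof (rule tannerys_theorem[THEN conjunct2, THEN conjunct2])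
    show "((\<lambda>h. \<bar>z h n\<bar> powr r) \<longlongrightarrow> 0) F" for n
      using tendsto_rabs[OF lim[of n]] r by (intro tendsto_zero_powrI) auto
    show "summable (\<lambda>n. \<bar>B n\<bar> powr r)"
      using B by (simp add: lq_def)
    have "eventually (\<lambda>h. \<forall>n. norm (\<bar>z h n\<bar> powr r) \<le> \<bar>B n\<bar> powr r) F"
      using bound
    proof eventually_elim
      case (elim h)
      then have "\<bar>z h n\<bar> \<le> \<bar>B n\<bar>" for n
        using abs_ge_self order_trans by blast
      then show ?case
        using r by (auto intro!: powr_mono2)
    qed
    \<comment> \<open>Tannery's theorem asks for domination along a product filter; here it holds
      for all \<open>n\<close> at once, so the condition on \<open>n\<close> is
      \<open>True\<close>.\<close>
    then show "eventually (\<lambda>(n, h). norm (\<bar>z h n\<bar> powr r) \<le> \<bar>B n\<bar> powr r) (at_top \<times>\<^sub>F F)"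
      unfolding eventually_prod_filter
      by (intro exI[of _ "\<lambda>_. True"] exI[of _ "\<lambda>h. \<forall>n. norm (\<bar>z h n\<bar> powr r) \<le> \<bar>B n\<bar> powr r"]) auto
  qed (rule F)
  then have "((\<lambda>h. \<Sum>n. \<bar>z h n\<bar> powr r) \<longlongrightarrow> 0) F" by simp
  \<comment> \<open>Where the domination fails the series may diverge and its \<open>suminf\<close>
    has no known sign, so nonnegativity is only claimed eventually.\<close>
  moreover have "eventually (\<lambda>h. 0 \<le> (\<Sum>n. \<bar>z h n\<bar> powr r)) F"
    using bound
  proof eventually_elim
    case (elim h)
    then have "z h \<in> lq r"
      using r by (intro lq_dominated[OF B r, of _ 1]) (auto intro: order_trans[OF _ abs_ge_self])
    then show ?case by (simp add: lq_def suminf_nonneg)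
  qed
  ultimately show ?thesis
    unfolding lq_norm_def using r by (intro tendsto_zero_powrI[where b = "1 / r"]) auto
qed

text \<open>By the mean value inequality \<open>B n\<close> bounds every difference quotient of the
  \<open>n\<close>-th coordinate, so the error against \<open>F' t\<close> is at most
  \<open>2 * B n\<close> for all \<open>h\<close>, and \<open>lq_norm_tendsto_0\<close>
  applies.\<close>

lemma lq_has_velocity_dominated:
  assumes r: "0 < r" and F: "\<And>t. F t \<in> lq r" and B: "B \<in> lq r"
    and deriv: "\<And>t n. ((\<lambda>t. F t n) has_real_derivative F' t n) (at t)"
    and bound: "\<And>t n. \<bar>F' t n\<bar> \<le> B n"
  shows "lq_has_velocity r F (F' t) t"
  unfolding lq_has_velocity_def
proof (intro conjI allI F)
  have B0: "0 \<le> B n" for n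
    using bound[of 0 n] by linarith
  show "F' t \<in> lq r"
    using bound B0 by (intro lq_dominated[OF B r, of _ 1]) auto
  show "((\<lambda>h. lq_norm r (\<lambda>n. (F (t + h) n - F t n) / h - F' t n)) \<longlongrightarrow> 0) (at 0)"
  proof (rule lq_norm_tendsto_0[OF r lq_scale[OF B r, of 2]])
    show "((\<lambda>h. (F (t + h) n - F t n) / h - F' t n) \<longlongrightarrow> 0) (at 0)" for n
      using deriv[of n t] unfolding DERIV_def by (rule LIM_zero)
    have "\<bar>(F (t + h) n - F t n) / h - F' t n\<bar> \<le> 2 * B n" for h n
    proof -
      have "norm (F (t + h) n - F t n) \<le> B n * norm ((t + h) - t)"
        by (rule field_differentiable_bound[where S = UNIV])
          (use deriv bound in \<open>auto intro: has_field_derivative_at_within\<close>)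
      \<comment> \<open>At \<open>h = 0\<close> the quotient is \<open>0\<close> by the convention
        for division by zero.\<close>
      then have "\<bar>(F (t + h) n - F t n) / h\<bar> \<le> B n"
        using B0[of n] by (cases "h = 0") (auto simp: abs_divide divide_le_eq)
      then show ?thesis
        using bound[of t n] by linarith
    qed
    then show "\<forall>\<^sub>F h in at 0. \<forall>n. \<bar>(F (t + h) n - F t n) / h - F' t n\<bar> \<le> 2 * B n"
      by simp
  qed simp
qed

lemma lq_C1_curve_dominated:
  assumes r: "0 < r" and F: "\<And>t. F t \<in> lq r" and B: "B \<in> lq r"
    and deriv: "\<And>t n. ((\<lambda>t. F t n) has_real_derivative F' t n) (at t)"
    and cont: "\<And>t n. isCont (\<lambda>t. F' t n) t"
    and bound: "\<And>t n. \<bar>F' t n\<bar> \<le> B n"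
  shows "lq_C1_curve r F"
  unfolding lq_C1_curve_def
proof (intro exI[of _ F'] conjI allI)
  fix t
  show "lq_has_velocity r F (F' t) t"
    by (rule lq_has_velocity_dominated[OF r F B deriv bound])
  show "((\<lambda>s. lq_norm r (\<lambda>n. F' s n - F' t n)) \<longlongrightarrow> 0) (at t)"
  proof (rule lq_norm_tendsto_0[OF r lq_scale[OF B r, of 2]])
    show "((\<lambda>s. F' s n - F' t n) \<longlongrightarrow> 0) (at t)" for n
      using cont[where t = t and n = n] unfolding isCont_def by (rule LIM_zero)
    have "\<bar>F' s n - F' t n\<bar> \<le> 2 * B n" for s n
      using bound[of s n] bound[of t n] by linarith
    then show "\<forall>\<^sub>F s in at t. \<forall>n. \<bar>F' s n - F' t n\<bar> \<le> 2 * B n"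
      by simp
  qed simp
qed

text \<open>Coordinates are bounded by the norm (\<open>abs_le_lq_norm\<close>), so convergence in
  norm passes to them. A velocity can thus be identified coordinate by coordinate.\<close>

lemma lq_has_velocity_component:
  assumes r: "0 < r" and c: "lq_has_velocity r c v t"
  shows "((\<lambda>s. c s n) has_real_derivative v n) (at t)"
  unfolding DERIV_def
proof (rule LIM_zero_cancel, rule Lim_null_comparison)
  have cl: "c s \<in> lq r" and vl: "v \<in> lq r" for s
    using c by (auto simp: lq_has_velocity_def)
  have "(\<lambda>n. (c (t + h) n - c t n) / h - v n) \<in> lq r" for h
    using lq_diff[OF lq_scale[OF lq_diff[OF cl cl r] r, of "1 / h"] vl r] by simp
  from abs_le_lq_norm[OF r this]
  show "\<forall>\<^sub>F h in at 0. norm ((c (t + h) n - c t n) / h - v n)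
      \<le> lq_norm r (\<lambda>n. (c (t + h) n - c t n) / h - v n)"
    by simp
  show "((\<lambda>h. lq_norm r (\<lambda>n. (c (t + h) n - c t n) / h - v n)) \<longlongrightarrow> 0) (at 0)"
    using c by (simp add: lq_has_velocity_def)
qed

section \<open>The inequalities of Young and Hoelder\<close>

text \<open>Young's inequality for \<open>\<bar>y\<bar>\<close> and \<open>x powr (q - 1)\<close>
  with conjugate exponents \<open>q\<close> and \<open>q / (q - 1)\<close>, multiplied by
  \<open>q\<close>; equality holds at \<open>y = x\<close>. The sign of \<open>y\<close> is free
  because a curve in the sphere may leave its positive part.\<close>

lemma powr_tangent_le:
  fixes x y q :: real
  assumes q: "1 < q" and x: "0 < x"
  shows "q * x powr (q - 1) * y \<le> \<bar>y\<bar> powr q + (q - 1) * x powr q"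
proof -
  have "\<bar>y\<bar> * x powr (q - 1) \<le> \<bar>y\<bar> powr q / q + (x powr (q - 1)) powr (q / (q - 1)) / (q / (q - 1))"
    by (rule Youngs_inequality) (use q in \<open>auto simp: field_simps\<close>)
  also have "(x powr (q - 1)) powr (q / (q - 1)) = x powr q"
    using q by (simp add: powr_powr)
  finally have "q * (\<bar>y\<bar> * x powr (q - 1)) \<le> q * (\<bar>y\<bar> powr q / q + x powr q / (q / (q - 1)))"
    using q by (intro mult_left_mono) auto
  also have "\<dots> = \<bar>y\<bar> powr q + (q - 1) * x powr q"
    using q by (simp add: field_simps)
  finally have "q * x powr (q - 1) * \<bar>y\<bar> \<le> \<bar>y\<bar> powr q + (q - 1) * x powr q"
    by (simp add: mult_ac)
  moreover have "q * x powr (q - 1) * y \<le> q * x powr (q - 1) * \<bar>y\<bar>"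
    using q by (intro mult_left_mono) auto
  ultimately show ?thesis by linarith
qed

lemma summable_powr_mult:
  fixes q :: real
  assumes q: "1 < q" and x: "x \<in> lq q" "\<And>n. 0 < x n" and z: "z \<in> lq q"
  shows "summable (\<lambda>n. x n powr (q - 1) * \<bar>z n\<bar>)"
proof (rule summable_comparison_test')
  show "summable (\<lambda>n. \<bar>z n\<bar> powr q + (q - 1) * \<bar>x n\<bar> powr q)"
    using x z by (auto simp: lq_def intro!: summable_add summable_mult)
  show "norm (x n powr (q - 1) * \<bar>z n\<bar>) \<le> \<bar>z n\<bar> powr q + (q - 1) * \<bar>x n\<bar> powr q" for n
  proof -
    \<comment> \<open>The factor \<open>q\<close> is inserted only to reach the left side of
      \<open>powr_tangent_le\<close>.\<close>
    have "1 * (x n powr (q - 1) * \<bar>z n\<bar>) \<le> q * (x n powr (q - 1) * \<bar>z n\<bar>)"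
      using q by (intro mult_right_mono) auto
    also have "\<dots> \<le> \<bar>z n\<bar> powr q + (q - 1) * \<bar>x n\<bar> powr q"
      using powr_tangent_le[OF q x(2)[of n], of "\<bar>z n\<bar>"] x(2)[of n] by (simp add: mult.assoc)
    finally show ?thesis by simp
  qed
qed

text \<open>Hoelder's inequality, with \<open>x powr (q - 1)\<close> of norm 1 in the dual space.
  Scaling \<open>z\<close> to norm 1 and summing \<open>powr_tangent_le\<close> gives the total
  \<open>1 + (q - 1) = q\<close> on the right, and dividing by \<open>q\<close> leaves the constant
  1.\<close>

lemma Hoelder_sphere:
  fixes q :: real
  assumes q: "1 < q" and x: "x \<in> lq_sphere q" "\<And>n. 0 < x n" and z: "z \<in> lq q"
  shows "\<bar>\<Sum>n. x n powr (q - 1) * z n\<bar> \<le> lq_norm q z"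
proof (cases "lq_norm q z = 0")
  case True
  have "z n = 0" for n
    using abs_le_lq_norm[OF _ z, of n] True q by simp
  then show ?thesis
    using True by simp
next
  case False
  define N where "N = lq_norm q z"
  have N: "0 < N"
    using False by (simp add: N_def lq_norm_def)
  have xl: "x \<in> lq q" and x1: "lq_norm q x = 1"
    using x(1) by (auto simp: lq_sphere_def)
  have sx: "(\<lambda>n. x n powr q) sums 1"
    using lq_norm_powr[OF _ xl] x1 q xl x(2) by (simp add: lq_def sums_iff less_imp_le)
  have sz: "(\<lambda>n. \<bar>z n\<bar> powr q) sums (N powr q)"
    using lq_norm_powr[OF _ z] q z by (simp add: lq_def sums_iff N_def)
  have sN: "(\<lambda>n. \<bar>z n / N\<bar> powr q) sums 1"
  proof -
    have "(\<lambda>n. \<bar>z n / N\<bar> powr q) = (\<lambda>n. \<bar>z n\<bar> powr q / N powr q)"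
      using N by (simp add: powr_divide abs_divide)
    then show ?thesis
      using sums_divide[OF sz, of "N powr q"] N by simp
  qed
  have s: "summable (\<lambda>n. x n powr (q - 1) * \<bar>z n\<bar>)"
    by (rule summable_powr_mult[OF q xl x(2) z])
  have "\<bar>\<Sum>n. x n powr (q - 1) * z n\<bar> \<le> (\<Sum>n. x n powr (q - 1) * \<bar>z n\<bar>)"
    using summable_rabs[of "\<lambda>n. x n powr (q - 1) * z n"] s by (simp add: abs_mult)
  moreover have "(q / N) * (\<Sum>n. x n powr (q - 1) * \<bar>z n\<bar>) \<le> 1 + (q - 1) * 1"
  proof (rule sums_le)
    show "(\<lambda>n. (q / N) * (x n powr (q - 1) * \<bar>z n\<bar>)) sums ((q / N) * (\<Sum>n. x n powr (q - 1) * \<bar>z n\<bar>))"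
      using s by (intro sums_mult summable_sums)
    show "(\<lambda>n. \<bar>z n / N\<bar> powr q + (q - 1) * x n powr q) sums (1 + (q - 1) * 1)"
      by (intro sums_add sums_mult sN sx)
    show "(q / N) * (x n powr (q - 1) * \<bar>z n\<bar>) \<le> \<bar>z n / N\<bar> powr q + (q - 1) * x n powr q" for n
      using powr_tangent_le[OF q x(2)[of n], of "\<bar>z n / N\<bar>"] N by (simp add: abs_divide mult_ac)
  qed
  then have "(\<Sum>n. x n powr (q - 1) * \<bar>z n\<bar>) \<le> N"
    using N q by (simp add: field_simps)
  ultimately show ?thesis by (simp add: N_def)
qed

section \<open>Curves built from bounded profiles\<close>

text \<open>Boundedness of \<open>\<eta>\<close>, \<open>\<tau>\<close> and their derivatives yields
  one majorant for the velocity at all times. The form is general enough to cover both the curve in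
  the simplex (exponent 1, profile \<open>bump\<close> to the power \<open>q\<close>) and its root
  (exponent \<open>q\<close>, profile \<open>bump\<close>).\<close>

lemma lq_C1_curve_separated:
  assumes r: "0 < r" and y: "y \<in> lq r" "(\<lambda>n. y n * a n) \<in> lq r"
    and \<eta>: "\<And>u. (\<eta> has_real_derivative \<eta>' u) (at u)" "\<And>u. isCont \<eta>' u"
      "bounded (range \<eta>)" "bounded (range \<eta>')"
    and \<tau>: "\<And>t. (\<tau> has_real_derivative \<tau>' t) (at t)" "\<And>t. isCont \<tau>' t"
      "bounded (range \<tau>)" "bounded (range \<tau>')"
  shows "lq_C1_curve r (\<lambda>t n. y n * \<eta> (t * a n) * \<tau> t)" (is "lq_C1_curve r ?F")
    and "lq_has_velocity r (\<lambda>t n. y n * \<eta> (t * a n) * \<tau> t)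
      (\<lambda>n. y n * a n * \<eta>' (t * a n) * \<tau> t + y n * \<eta> (t * a n) * \<tau>' t) t"
proof -
  let ?F' = "\<lambda>t n. y n * a n * \<eta>' (t * a n) * \<tau> t + y n * \<eta> (t * a n) * \<tau>' t"
  obtain C where C: "\<bar>\<eta> u\<bar> \<le> C" for u
    using \<eta>(3) by (auto simp: bounded_iff)
  obtain C' where C': "\<bar>\<eta>' u\<bar> \<le> C'" for u
    using \<eta>(4) by (auto simp: bounded_iff)
  obtain D where D: "\<bar>\<tau> u\<bar> \<le> D" for u
    using \<tau>(3) by (auto simp: bounded_iff)
  obtain D' where D': "\<bar>\<tau>' u\<bar> \<le> D'" for u
    using \<tau>(4) by (auto simp: bounded_iff)
  have nonneg: "0 \<le> C" "0 \<le> C'" "0 \<le> D" "0 \<le> D'"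
    using C[of 0] C'[of 0] D[of 0] D'[of 0] by linarith+
  define B where "B n = (C' * D) * \<bar>y n * a n\<bar> + (C * D') * \<bar>y n\<bar>" for n
  have B: "B \<in> lq r"
    unfolding B_def using y r by (intro lq_add lq_scale) (simp_all only: lq_abs)
  have F: "?F t \<in> lq r" for t
  proof (rule lq_dominated[OF y(1) r, of _ "C * D"])
    show "\<bar>?F t n\<bar> \<le> C * D * \<bar>y n\<bar>" for n
      using mult_mono[OF C[of "t * a n"] D[of t]] nonneg
        mult_left_mono[of "\<bar>\<eta> (t * a n)\<bar> * \<bar>\<tau> t\<bar>" "C * D" "\<bar>y n\<bar>"]
      by (simp add: abs_mult mult_ac)
  qed
  have deriv: "((\<lambda>t. ?F t n) has_real_derivative ?F' t n) (at t)" for t n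
  proof -
    have "((\<lambda>t. \<eta> (t * a n)) has_real_derivative \<eta>' (t * a n) * a n) (at t)"
      by (rule DERIV_chain2[OF \<eta>(1)]) (auto intro!: derivative_eq_intros)
    from DERIV_mult[OF DERIV_cmult[OF this, of "y n"] \<tau>(1)[of t]] show ?thesis
      by (simp add: mult_ac)
  qed
  have cont: "isCont (\<lambda>t. ?F' t n) t" for t n
  proof -
    have "isCont (\<lambda>t. \<eta>' (t * a n)) t" "isCont (\<lambda>t. \<eta> (t * a n)) t"
      using isCont_o2[of t "\<lambda>t. t * a n" \<eta>'] isCont_o2[of t "\<lambda>t. t * a n" \<eta>]
        \<eta>(2) DERIV_isCont[OF \<eta>(1)] by auto
    then show ?thesis
      by (intro continuous_intros \<tau>(2) DERIV_isCont[OF \<tau>(1)])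
  qed
  have bound: "\<bar>?F' t n\<bar> \<le> B n" for t n
  proof -
    have "\<bar>y n * a n * \<eta>' (t * a n) * \<tau> t\<bar> \<le> C' * D * \<bar>y n * a n\<bar>"
      using mult_mono[OF C'[of "t * a n"] D[of t]] nonneg
        mult_left_mono[of "\<bar>\<eta>' (t * a n)\<bar> * \<bar>\<tau> t\<bar>" "C' * D" "\<bar>y n * a n\<bar>"]
      by (simp add: abs_mult mult_ac)
    moreover have "\<bar>y n * \<eta> (t * a n) * \<tau>' t\<bar> \<le> C * D' * \<bar>y n\<bar>"
      using mult_mono[OF C[of "t * a n"] D'[of t]] nonneg
        mult_left_mono[of "\<bar>\<eta> (t * a n)\<bar> * \<bar>\<tau>' t\<bar>" "C * D'" "\<bar>y n\<bar>"]
      by (simp add: abs_mult mult_ac)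
    ultimately show ?thesis
      unfolding B_def by linarith
  qed
  show "lq_C1_curve r ?F"
    by (rule lq_C1_curve_dominated[OF r F B deriv cont bound])
  show "lq_has_velocity r ?F (?F' t) t"
    by (rule lq_has_velocity_dominated[OF r F B deriv bound])
qed

section \<open>Differentiation of sums along curves in \<open>lq 1\<close>\<close>

lemma suminf_le_lq_norm:
  assumes "z \<in> lq 1"
  shows "\<bar>\<Sum>n. z n\<bar> \<le> lq_norm 1 z"
proof -
  have s: "summable (\<lambda>n. \<bar>z n\<bar>)"
    using assms by (simp add: lq_1_iff)
  show ?thesis
    using summable_rabs[OF s] suminf_nonneg[OF s] by (simp add: lq_norm_def)
qed

lemma lq_1_summable: "x \<in> lq 1 \<Longrightarrow> summable x"
  by (simp add: lq_1_iff summable_rabs_cancel)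

text \<open>Summation is a linear functional on \<open>lq 1\<close> bounded by the norm, so it
  commutes with the limit of difference quotients.\<close>

lemma lq_has_velocity_suminf:
  assumes c: "lq_has_velocity 1 c v t"
  shows "((\<lambda>s. \<Sum>n. c s n) has_real_derivative (\<Sum>n. v n)) (at t)"
  unfolding DERIV_def
proof (rule LIM_zero_cancel, rule Lim_null_comparison)
  have cl: "c s \<in> lq 1" and vl: "v \<in> lq 1" for s
    using c by (auto simp: lq_has_velocity_def)
  have "\<bar>((\<Sum>n. c (t + h) n) - (\<Sum>n. c t n)) / h - (\<Sum>n. v n)\<bar>
      \<le> lq_norm 1 (\<lambda>n. (c (t + h) n - c t n) / h - v n)" for h
  proof -
    have z: "(\<lambda>n. (c (t + h) n - c t n) / h - v n) \<in> lq 1"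
      using lq_diff[OF lq_scale[OF lq_diff[OF cl cl], of "1 / h"] vl] by simp
    have "(\<lambda>n. (c (t + h) n - c t n) / h - v n) sums
        (((\<Sum>n. c (t + h) n) - (\<Sum>n. c t n)) / h - (\<Sum>n. v n))"
      by (intro sums_diff sums_divide summable_sums lq_1_summable cl vl)
    then show ?thesis
      using suminf_le_lq_norm[OF z] by (simp add: sums_iff)
  qed
  then show "\<forall>\<^sub>F h in at 0. norm (((\<Sum>n. c (t + h) n) - (\<Sum>n. c t n)) / h - (\<Sum>n. v n))
      \<le> lq_norm 1 (\<lambda>n. (c (t + h) n - c t n) / h - v n)"
    by simp
  show "((\<lambda>h. lq_norm 1 (\<lambda>n. (c (t + h) n - c t n) / h - v n)) \<longlongrightarrow> 0) (at 0)"
    using c by (simp add: lq_has_velocity_def)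
qed

text \<open>The same bound carries over the continuity of the velocity. This supplies a
  \<open>C1\<close> normalising factor for curves in the simplex.\<close>

lemma lq_C1_curve_suminf:
  assumes "lq_C1_curve 1 c"
  obtains S' where "\<And>t. ((\<lambda>s. \<Sum>n. c s n) has_real_derivative S' t) (at t)" "\<And>t. isCont S' t"
proof -
  obtain c' where c': "\<And>t. lq_has_velocity 1 c (c' t) t"
      "\<And>t. ((\<lambda>s. lq_norm 1 (\<lambda>n. c' s n - c' t n)) \<longlongrightarrow> 0) (at t)"
    using assms by (auto simp: lq_C1_curve_def)
  have l: "c' t \<in> lq 1" for t
    using c'(1)[of t] by (simp add: lq_has_velocity_def)
  have "isCont (\<lambda>t. \<Sum>n. c' t n) t" for t
    unfolding isCont_def
  proof (rule LIM_zero_cancel, rule Lim_null_comparison[OF _ c'(2)])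
    have "\<bar>(\<Sum>n. c' s n) - (\<Sum>n. c' t n)\<bar> \<le> lq_norm 1 (\<lambda>n. c' s n - c' t n)" for s
      using suminf_le_lq_norm[OF lq_diff[OF l l]]
      by (simp add: suminf_diff[OF lq_1_summable[OF l] lq_1_summable[OF l]])
    then show "\<forall>\<^sub>F s in at t. norm ((\<Sum>n. c' s n) - (\<Sum>n. c' t n))
        \<le> lq_norm 1 (\<lambda>n. c' s n - c' t n)"
      by simp
  qed
  with lq_has_velocity_suminf[OF c'(1)] show thesis
    by (rule that)
qed

section \<open>A bounded profile in place of a straight line\<close>

text \<open>A straight line through \<open>p\<close> can leave the simplex for every \<open>t \<noteq> 0\<close>, namely when
  \<open>v n / p n\<close> is unbounded; \<open>bump u\<close> agrees with \<open>1 + u\<close> to first order at \<open>0\<close> but stays between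
  \<open>1 / 2\<close> and \<open>3 / 2\<close>.\<close>

definition bump :: "real \<Rightarrow> real" where
  "bump u = 1 + u / (1 + u\<^sup>2)"

definition bump_deriv :: "real \<Rightarrow> real" where
  "bump_deriv u = (1 - u\<^sup>2) / (1 + u\<^sup>2)\<^sup>2"

lemma one_plus_square_neq_0: "1 + u\<^sup>2 \<noteq> (0::real)"
  by (metis add_pos_nonneg less_numeral_extra(1,3) zero_le_power2)

lemma bump_bounds: "1 / 2 \<le> bump u" "bump u \<le> 3 / 2"
proof -
  have *: "0 < 1 + u\<^sup>2"
    by (simp add: add_pos_nonneg)
  \<comment> \<open>After clearing the positive denominator, the two bounds say that the squares of
    \<open>u + 1\<close> and \<open>u - 1\<close> are nonnegative.\<close>
  show "1 / 2 \<le> bump u"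
    using * sum_squares_ge_zero[of "u + 1" 0] unfolding bump_def
    by (simp add: field_simps power2_eq_square)
  show "bump u \<le> 3 / 2"
    using * sum_squares_ge_zero[of "u - 1" 0] unfolding bump_def
    by (simp add: field_simps power2_eq_square)
qed

lemma bump_pos: "0 < bump u"
  using bump_bounds(1)[of u] by linarith

lemma abs_bump_deriv_le: "\<bar>bump_deriv u\<bar> \<le> 1"
proof -
  have "\<bar>1 - u\<^sup>2\<bar> \<le> 1 * (1 + u\<^sup>2)"
    by (simp add: abs_le_iff)
  also have "\<dots> \<le> (1 + u\<^sup>2) * (1 + u\<^sup>2)"
    by (intro mult_right_mono) auto
  finally show ?thesis
    by (simp add: bump_deriv_def abs_divide divide_le_eq power2_eq_square)
qed

lemma DERIV_bump: "(bump has_real_derivative bump_deriv u) (at u)"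
  unfolding bump_def[abs_def] bump_deriv_def
  using one_plus_square_neq_0[of u]
  by (auto intro!: derivative_eq_intros simp: power2_eq_square field_simps)

lemma isCont_bump_deriv: "isCont bump_deriv u"
  unfolding bump_deriv_def[abs_def] by (intro continuous_intros) (simp add: one_plus_square_neq_0)

section \<open>The root transform and its differential\<close>

text \<open>The differential of \<open>root_transform q\<close> at \<open>p\<close>, as the chain
  rule gives it in each coordinate.\<close>

definition d_root :: "real \<Rightarrow> (nat \<Rightarrow> real) \<Rightarrow> (nat \<Rightarrow> real) \<Rightarrow> nat \<Rightarrow> real" where
  "d_root q p v = (\<lambda>n. v n * p n powr (1 / q - 1) / q)"

lemma simplexD:
  assumes "p \<in> simplex"
  shows "p \<in> lq 1" "p sums 1" "0 < p n"
  using assms by (auto simp: simplex_def sums_iff lq_1_summable)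

lemma root_transform_pos: "p \<in> simplex \<Longrightarrow> 0 < root_transform q p n"
  using simplexD(3)[of p n] by (simp add: root_transform_def)

lemma root_transform_in_sphere:
  assumes "0 < q" "p \<in> simplex"
  shows "root_transform q p \<in> lq_sphere q"
proof -
  have "\<bar>root_transform q p n\<bar> powr q = p n" for n
    using assms simplexD(3)[OF assms(2), of n] by (simp add: root_transform_def powr_powr)
  then show ?thesis
    using simplexD(2)[OF assms(2)] by (simp add: lq_sphere_def lq_def lq_norm_def sums_iff)
qed

lemma bij_betw_root_transform:
  assumes q: "0 < q"
  shows "bij_betw (root_transform q) simplex {x \<in> lq_sphere q. \<forall>n. 0 < x n}"
proof (rule bij_betw_byWitness[where f' = "\<lambda>x n. x n powr q"])
  show "\<forall>p\<in>simplex. (\<lambda>n. root_transform q p n powr q) = p"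
    using q by (auto simp: root_transform_def powr_powr simplexD(3) less_imp_le)
  show "\<forall>x\<in>{x \<in> lq_sphere q. \<forall>n. 0 < x n}. root_transform q (\<lambda>n. x n powr q) = x"
    using q by (auto simp: root_transform_def powr_powr less_imp_le)
  show "root_transform q ` simplex \<subseteq> {x \<in> lq_sphere q. \<forall>n. 0 < x n}"
    using q by (auto simp: root_transform_in_sphere root_transform_pos)
  show "(\<lambda>x n. x n powr q) ` {x \<in> lq_sphere q. \<forall>n. 0 < x n} \<subseteq> simplex"
  proof clarify
    fix x assume x: "x \<in> lq_sphere q" "\<forall>n. 0 < x n"
    then have "(\<lambda>n. x n powr q) sums 1"
      using lq_norm_powr[OF q, of x] by (simp add: lq_sphere_def lq_def sums_iff less_imp_le)
    then show "(\<lambda>n. x n powr q) \<in> simplex"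
      using x(2) by (auto simp: simplex_def lq_1_iff sums_iff less_imp_neq[symmetric])
  qed
qed

section \<open>Curves in the simplex and their images\<close>

lemma simplex_curve_exists:
  assumes q: "1 < q" and p: "p \<in> simplex" and v: "v \<in> simplex_tangent q p"
  shows "\<exists>c. curve_through q (Delta q) c p v"
proof -
  have p_pos: "0 < p n" for n
    by (rule simplexD(3)[OF p])
  have v1: "v \<in> lq 1" and v0: "(\<Sum>n. v n) = 0" and vq: "(\<lambda>n. v n * p n powr (1 / q - 1)) \<in> lq q"
    using v by (auto simp: simplex_tangent_def)
  \<comment> \<open>The profile \<psi> is a \<open>q\<close>-th power so that the root of the curve
    contains \<open>bump\<close> itself. Its derivative at \<open>0\<close> is \<open>q\<close>,
    hence the factor \<open>1 / q\<close> in \<open>a\<close>: then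
    \<open>q * p n * a n = v n\<close>, and \<open>root_transform q p n * a n\<close> is
    \<open>d_root q p v n\<close>.\<close>
  define a where "a n = v n / (q * p n)" for n
  define \<psi> where "\<psi> u = bump u powr q" for u
  define \<psi>' where "\<psi>' u = q * bump u powr (q - 1) * bump_deriv u" for u
  have pa: "p n * a n = 1 / q * v n" for n
    using q p_pos[of n] by (simp add: a_def)
  have pa1: "(\<lambda>n. p n * a n) \<in> lq 1"
    unfolding pa by (rule lq_scale[OF v1]) simp
  \<comment> \<open>Up to the factor \<open>1 / q\<close> this is the second condition in
    \<open>simplex_tangent\<close>.\<close>
  have xa: "(\<lambda>n. root_transform q p n * a n) \<in> lq q"
  proof -
    have "root_transform q p n * a n = 1 / q * (v n * p n powr (1 / q - 1))" for n
      using q p_pos[of n] by (simp add: root_transform_def a_def powr_diff)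
    then show ?thesis
      using lq_scale[OF vq, of "1 / q"] q by simp
  qed
  have bump: "bounded (range bump)" "bounded (range bump_deriv)"
    using abs_bump_deriv_le bump_bounds(2) bump_pos less_imp_le[OF bump_pos]
    unfolding bounded_iff by (metis abs_of_pos rangeE real_norm_def)+
  have D\<psi>: "(\<psi> has_real_derivative \<psi>' u) (at u)" for u
    using DERIV_fun_powr[OF DERIV_bump bump_pos] unfolding \<psi>_def[abs_def] \<psi>'_def by simp
  have C\<psi>': "isCont \<psi>' u" for u
    unfolding \<psi>'_def[abs_def] using bump_pos[of u]
    by (intro continuous_intros isCont_bump_deriv DERIV_isCont[OF DERIV_bump]) auto
  have \<psi>_le: "\<psi> u \<le> (3 / 2) powr q" "(1 / 2) powr q \<le> \<psi> u" for u
    unfolding \<psi>_def using q bump_bounds[of u] bump_pos[of u] by (auto intro!: powr_mono2)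
  have \<psi>'_le: "\<bar>\<psi>' u\<bar> \<le> q * (3 / 2) powr (q - 1)" for u
  proof -
    have "bump u powr (q - 1) * \<bar>bump_deriv u\<bar> \<le> (3 / 2) powr (q - 1) * 1"
      using q bump_bounds[of u] bump_pos[of u] abs_bump_deriv_le[of u]
      by (intro mult_mono powr_mono2) auto
    then have "q * (bump u powr (q - 1) * \<bar>bump_deriv u\<bar>) \<le> q * ((3 / 2) powr (q - 1) * 1)"
      using q by (intro mult_left_mono) auto
    then show ?thesis
      using q by (simp add: \<psi>'_def abs_mult mult.assoc)
  qed
  have \<psi>: "bounded (range \<psi>)" "bounded (range \<psi>')"
    using \<psi>_le(1) \<psi>'_le by (auto simp: bounded_iff \<psi>_def)
  define S where "S t = (\<Sum>n. p n * \<psi> (t * a n))" for t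
  have S_eq: "S = (\<lambda>t. \<Sum>n. p n * \<psi> (t * a n))"
    by (simp add: S_def[abs_def])
  have const: "bounded (range (\<lambda>_::real. c))" for c :: real
    by (auto simp: bounded_iff)
  \<comment> \<open>The time factor is taken constant here, since the normaliser has yet to be shown
    differentiable.\<close>
  have C1: "lq_C1_curve 1 (\<lambda>t n. p n * \<psi> (t * a n))"
    and vel1: "lq_has_velocity 1 (\<lambda>t n. p n * \<psi> (t * a n)) (\<lambda>n. p n * a n * \<psi>' (t * a n)) t" for t
    using lq_C1_curve_separated[OF _ simplexD(1)[OF p] pa1 D\<psi> C\<psi>' \<psi>, of "\<lambda>_. 1" "\<lambda>_. 0"] const
    by simp_all
  obtain S' where S': "\<And>t. (S has_real_derivative S' t) (at t)" "\<And>t. isCont S' t"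
    by (rule lq_C1_curve_suminf[OF C1, folded S_eq]) (rule that)
  \<comment> \<open>The derivative obtained above comes with continuity but no formula; uniqueness
    of derivatives provides one.\<close>
  have S'_eq: "S' t = (\<Sum>n. p n * a n * \<psi>' (t * a n))" for t
    by (rule DERIV_unique[OF S'(1) lq_has_velocity_suminf[OF vel1, folded S_eq]])
  have F1: "(\<lambda>n. p n * \<psi> (t * a n)) \<in> lq 1" for t
    using vel1[of t] by (simp add: lq_has_velocity_def)
  have F'1: "(\<lambda>n. p n * a n * \<psi>' (t * a n)) \<in> lq 1" for t
    using vel1[of t] by (simp add: lq_has_velocity_def)
  \<comment> \<open>A lower bound uniform in \<open>t\<close> keeps the negative powers of
    \<open>S\<close> and their derivatives bounded.\<close>
  have S_ge: "(1 / 2) powr q \<le> S t" for t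
  proof (rule sums_le)
    show "(\<lambda>n. p n * (1 / 2) powr q) sums ((1 / 2) powr q)"
      using sums_mult2[OF simplexD(2)[OF p]] by simp
    show "(\<lambda>n. p n * \<psi> (t * a n)) sums S t"
      unfolding S_def by (intro summable_sums lq_1_summable F1)
  qed (use \<psi>_le p_pos in \<open>simp add: less_imp_le\<close>)
  then have S_pos: "0 < S t" for t
    by (rule less_le_trans[rotated]) simp
  have "\<bar>S' t\<bar> \<le> (\<Sum>n. \<bar>p n * a n\<bar> * (q * (3 / 2) powr (q - 1)))" for t
  proof -
    have "\<bar>S' t\<bar> \<le> (\<Sum>n. \<bar>p n * a n * \<psi>' (t * a n)\<bar>)"
      unfolding S'_eq by (rule summable_rabs) (use F'1 in \<open>simp add: lq_1_iff\<close>)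
    also have "\<dots> \<le> (\<Sum>n. \<bar>p n * a n\<bar> * (q * (3 / 2) powr (q - 1)))"
    proof (rule suminf_le)
      show "\<bar>p n * a n * \<psi>' (t * a n)\<bar> \<le> \<bar>p n * a n\<bar> * (q * (3 / 2) powr (q - 1))" for n
        unfolding abs_mult[of "p n * a n"] by (intro mult_left_mono \<psi>'_le) simp
    qed (use F'1 pa1 in \<open>simp_all only: lq_1_iff summable_mult2\<close>)
    finally show ?thesis .
  qed
  then obtain K where K: "\<And>t. \<bar>S' t\<bar> \<le> K"
    by blast
  \<comment> \<open>Two exponents occur: \<open>s = 1\<close> normalises the curve, and
    \<open>s = 1 / q\<close> appears in its root.\<close>
  define \<tau> where "\<tau> s t = S t powr (-s)" for s t
  define \<tau>' where "\<tau>' s t = - s * S t powr (- s - 1) * S' t" for s t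
  have D\<tau>: "(\<tau> s has_real_derivative \<tau>' s t) (at t)" for s t
    using DERIV_fun_powr[OF S'(1) S_pos, of "- s"] unfolding \<tau>_def[abs_def] \<tau>'_def by simp
  have C\<tau>': "isCont (\<tau>' s) t" for s t
    unfolding \<tau>'_def[abs_def] using S_pos[of t]
    by (intro continuous_intros S'(2) DERIV_isCont[OF S'(1)]) auto
  have S_powr: "S t powr (- s) \<le> ((1 / 2) powr q) powr (- s)" if "0 \<le> s" for s t
    using that S_ge by (intro powr_mono2') auto
  have \<tau>: "bounded (range (\<tau> s))" "bounded (range (\<tau>' s))" if s: "0 \<le> s" for s
  proof -
    show "bounded (range (\<tau> s))"
      using S_powr[OF s] by (auto simp: bounded_iff \<tau>_def)
    have "\<bar>\<tau>' s t\<bar> \<le> s * ((1 / 2) powr q) powr (- (s + 1)) * K" for t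
      unfolding \<tau>'_def abs_mult using s S_powr[of "s + 1" t] K[of t]
      by (intro mult_mono) auto
    then show "bounded (range (\<tau>' s))"
      by (auto simp: bounded_iff)
  qed
  have S0: "S 0 = 1"
    using simplexD(2)[OF p] by (simp add: S_def \<psi>_def bump_def sums_iff)
  \<comment> \<open>At \<open>0\<close> the derivative is the sum of \<open>v\<close>, which
    vanishes by tangency; so normalising does not alter the velocity there.\<close>
  have S'0: "S' 0 = 0"
    using v0 v1 q by (simp add: S'_eq \<psi>'_def pa bump_def bump_deriv_def)
  define c where "c t n = p n * \<psi> (t * a n) * \<tau> 1 t" for t n
  have c_pos: "0 < c t n" for t n
    using p_pos[of n] bump_pos[of "t * a n"] S_pos[of t] by (simp add: c_def \<psi>_def \<tau>_def)
  have c_simplex: "c t \<in> simplex" for t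
  proof -
    have "c t sums (S t * \<tau> 1 t)"
      unfolding c_def[abs_def] S_def by (intro sums_mult2 summable_sums lq_1_summable F1)
    then have "c t sums 1"
      using S_pos[of t] by (simp add: \<tau>_def powr_minus)
    then show ?thesis
      using c_pos by (simp add: simplex_def lq_1_iff sums_iff abs_of_pos)
  qed
  have "(root_transform q \<circ> c) t n = root_transform q p n * bump (t * a n) * \<tau> (1 / q) t" for t n
    using q p_pos[of n] bump_pos[of "t * a n"] S_pos[of t]
    by (simp add: c_def root_transform_def \<psi>_def \<tau>_def powr_mult powr_divide powr_powr powr_minus_divide)
  then have root_c: "root_transform q \<circ> c
      = (\<lambda>t n. root_transform q p n * bump (t * a n) * \<tau> (1 / q) t)"
    by blast
  have "root_transform q p \<in> lq q"
    using root_transform_in_sphere[of q p] p q by (simp add: lq_sphere_def)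
  then have "lq_C1_curve q (root_transform q \<circ> c)"
    unfolding root_c using q
    by (intro lq_C1_curve_separated(1)[OF _ _ xa DERIV_bump isCont_bump_deriv bump D\<tau> C\<tau>' \<tau>]) auto
  moreover have "lq_has_velocity 1 c v 0"
    using lq_C1_curve_separated(2)[OF _ simplexD(1)[OF p] pa1 D\<psi> C\<psi>' \<psi> D\<tau>[of 1] C\<tau>'[where s = 1] \<tau>[of 1],
      where t = 0] q
    by (simp add: c_def[abs_def] pa \<tau>_def \<tau>'_def S0 S'0 \<psi>'_def bump_def bump_deriv_def)
  moreover have "c 0 = p"
    by (simp add: c_def[abs_def] \<psi>_def \<tau>_def S0 bump_def)
  ultimately show ?thesis
    using c_simplex by (auto simp: curve_through_def Delta_def)
qed

text \<open>Since the root transform is the chart of \<open>Delta q\<close>, the image curve is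
  \<open>C1\<close> in \<open>lq q\<close> by definition and already has some velocity. Only its
  coordinates remain to be found, by the chain rule.\<close>

lemma root_transform_curve_through:
  assumes q: "1 < q" and c: "curve_through q (Delta q) c p v"
  shows "curve_through q (rescale k (positive_sphere q)) (root_transform q \<circ> c)
    (root_transform q p) (d_root q p v)"
proof -
  have cs: "c t \<in> simplex" and C1: "lq_C1_curve q (root_transform q \<circ> c)"
    and c0: "c 0 = p" and vel: "lq_has_velocity 1 c v 0" for t
    using c by (auto simp: curve_through_def Delta_def)
  obtain w where w: "lq_has_velocity q (root_transform q \<circ> c) w 0"
    using C1 by (auto simp: lq_C1_curve_def)
  have "w = d_root q p v"
  proof
    fix n
    have "0 < c 0 n"
      by (rule simplexD(3)[OF cs])
    then have "((\<lambda>t. c t n powr (1 / q)) has_real_derivative d_root q p v n) (at 0)"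
      using DERIV_fun_powr[OF lq_has_velocity_component[OF _ vel, of n], of "1 / q"] c0
      by (simp add: d_root_def mult_ac)
    moreover have "((\<lambda>t. c t n powr (1 / q)) has_real_derivative w n) (at 0)"
      using lq_has_velocity_component[OF _ w, of n] q by (simp add: root_transform_def)
    ultimately show "w n = d_root q p v n"
      by (rule DERIV_unique[rotated])
  qed
  with w C1 cs c0 q show ?thesis
    by (auto simp: curve_through_def rescale_def positive_sphere_def comp_def
        root_transform_in_sphere root_transform_pos)
qed

section \<open>The tangent spaces of the sphere\<close>

text \<open>The maximum argument uses only a supporting functional at \<open>x\<close>, so the norm
  itself is never differentiated.\<close>

lemma sphere_tangent_orthogonal:
  assumes q: "1 < q" and x: "x \<in> lq_sphere q" "\<And>n. 0 < x n" and w: "w \<in> sphere_tangent q x"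
  shows "(\<Sum>n. x n powr (q - 1) * w n) = 0"
proof -
  obtain c where c: "\<And>t. c t \<in> lq_sphere q" "c 0 = x" "lq_has_velocity q c w 0"
    using w by (auto simp: sphere_tangent_def)
  have cl: "c t \<in> lq q" "lq_norm q (c t) = 1" for t
    using c(1)[of t] by (auto simp: lq_sphere_def)
  have wl: "w \<in> lq q"
    using c(3) by (simp add: lq_has_velocity_def)
  have xl: "x \<in> lq q"
    using x(1) by (simp add: lq_sphere_def)
  define \<Lambda> where "\<Lambda> z = (\<Sum>n. x n powr (q - 1) * z n)" for z :: "nat \<Rightarrow> real"
  have s: "(\<lambda>n. x n powr (q - 1) * z n) sums \<Lambda> z" if "z \<in> lq q" for z
  proof -
    have "summable (\<lambda>n. \<bar>x n powr (q - 1) * z n\<bar>)"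
      using summable_powr_mult[OF q xl x(2) that] by (simp add: abs_mult)
    then show ?thesis
      unfolding \<Lambda>_def by (intro summable_sums) (rule summable_rabs_cancel)
  qed
  have \<Lambda>x: "\<Lambda> x = 1"
  proof -
    have "x n powr (q - 1) * x n = \<bar>x n\<bar> powr q" for n
      using x(2)[of n] by (simp add: powr_diff)
    then show ?thesis
      using lq_norm_powr[OF _ xl] x(1) q by (simp add: \<Lambda>_def lq_sphere_def)
  qed
  have \<Lambda>c: "\<Lambda> (c t) \<le> 1" for t
  proof -
    have "q * \<Lambda> (c t) \<le> 1 + (q - 1) * 1"
    proof (rule sums_le)
      show "(\<lambda>n. q * (x n powr (q - 1) * c t n)) sums (q * \<Lambda> (c t))"
        by (intro sums_mult s cl)
      have sph: "(\<lambda>n. \<bar>z n\<bar> powr q) sums 1" if "z \<in> lq_sphere q" for z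
        using lq_norm_powr[of q z] that q by (simp add: lq_sphere_def lq_def sums_iff)
      show "(\<lambda>n. \<bar>c t n\<bar> powr q + (q - 1) * \<bar>x n\<bar> powr q) sums (1 + (q - 1) * 1)"
        by (intro sums_add sums_mult sph c(1) x(1))
      show "q * (x n powr (q - 1) * c t n) \<le> \<bar>c t n\<bar> powr q + (q - 1) * \<bar>x n\<bar> powr q" for n
        using powr_tangent_le[OF q x(2)[of n], of "c t n"] x(2)[of n] by (simp add: mult.assoc)
    qed
    then show ?thesis
      using q by simp
  qed
  \<comment> \<open>\<open>\<Lambda>\<close> is bounded by the norm (\<open>Hoelder_sphere\<close>),
    so it may be applied to the limit defining the velocity.\<close>
  have "((\<lambda>t. \<Lambda> (c t)) has_real_derivative \<Lambda> w) (at 0)"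
    unfolding DERIV_def
  proof (rule LIM_zero_cancel, rule Lim_null_comparison)
    have "\<bar>(\<Lambda> (c (0 + h)) - \<Lambda> (c 0)) / h - \<Lambda> w\<bar> \<le> lq_norm q (\<lambda>n. (c (0 + h) n - c 0 n) / h - w n)" for h
    proof -
      have z: "(\<lambda>n. (c (0 + h) n - c 0 n) / h - w n) \<in> lq q"
        using lq_diff[OF lq_scale[OF lq_diff[OF cl(1) cl(1)], where k = "1 / h"] wl] q by simp
      have "(\<lambda>n. (x n powr (q - 1) * c (0 + h) n - x n powr (q - 1) * c 0 n) / h - x n powr (q - 1) * w n)
          sums ((\<Lambda> (c (0 + h)) - \<Lambda> (c 0)) / h - \<Lambda> w)"
        by (intro sums_diff sums_divide s cl wl)
      then have "(\<lambda>n. x n powr (q - 1) * ((c (0 + h) n - c 0 n) / h - w n))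
          sums ((\<Lambda> (c (0 + h)) - \<Lambda> (c 0)) / h - \<Lambda> w)"
        by (simp add: right_diff_distrib)
      then show ?thesis
        using Hoelder_sphere[OF q x z] by (simp only: sums_iff)
    qed
    then show "\<forall>\<^sub>F h in at 0. norm ((\<Lambda> (c (0 + h)) - \<Lambda> (c 0)) / h - \<Lambda> w)
        \<le> lq_norm q (\<lambda>n. (c (0 + h) n - c 0 n) / h - w n)"
      by simp
    show "((\<lambda>h. lq_norm q (\<lambda>n. (c (0 + h) n - c 0 n) / h - w n)) \<longlongrightarrow> 0) (at 0)"
      using c(3) by (simp add: lq_has_velocity_def)
  qed
  \<comment> \<open>The maximum at \<open>0\<close> is global; the radius \<open>1\<close> is
    arbitrary.\<close>
  then have "\<Lambda> w = 0"
    by (rule DERIV_local_max[of _ _ _ 1]) (simp_all add: \<Lambda>c c(2) \<Lambda>x)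
  then show ?thesis
    by (simp add: \<Lambda>_def)
qed

lemma d_root_in_sphere_tangent:
  assumes q: "1 < q" and p: "p \<in> simplex" and v: "v \<in> simplex_tangent q p"
  shows "d_root q p v \<in> sphere_tangent q (root_transform q p)"
proof -
  obtain c where "curve_through q (Delta q) c p v"
    using simplex_curve_exists[OF q p v] by blast
  from root_transform_curve_through[OF q this] show ?thesis
    unfolding sphere_tangent_def
    by (auto simp: curve_through_def rescale_def positive_sphere_def comp_def
        intro!: exI[of _ "root_transform q \<circ> c"])
qed

text \<open>The inverse is multiplication by \<open>q * x powr (q - 1)\<close>, the differential of
  the \<open>q\<close>-th power at the root \<open>x\<close> of \<open>p\<close>. Its values are
  summable by \<open>summable_powr_mult\<close> and sum to zero by
  \<open>sphere_tangent_orthogonal\<close>.\<close>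

lemma bij_betw_d_root:
  assumes q: "1 < q" and p: "p \<in> simplex"
  shows "bij_betw (d_root q p) (simplex_tangent q p) (sphere_tangent q (root_transform q p))"
proof -
  let ?x = "root_transform q p"
  let ?inv = "\<lambda>w n. q * (?x n powr (q - 1) * w n)"
  have p_pos: "0 < p n" for n
    by (rule simplexD(3)[OF p])
  have x: "?x \<in> lq_sphere q" "\<And>n. 0 < ?x n"
    using p q by (auto simp: root_transform_in_sphere root_transform_pos)
  have "?x n powr (q - 1) = p n powr (1 - 1 / q)" for n
    using q by (simp add: root_transform_def powr_powr field_simps)
  \<comment> \<open>The exponents of \<open>p n\<close> are \<open>1 / q - 1\<close> and
    \<open>1 - 1 / q\<close>, which add to zero.\<close>
  then have cancel: "p n powr (1 / q - 1) * ?x n powr (q - 1) = 1" for n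
    using p_pos[of n] by (simp flip: powr_add)
  have inv1: "?inv (d_root q p v) = v" for v
    using cancel q by (auto simp: d_root_def mult_ac)
  have inv2: "?inv w n * p n powr (1 / q - 1) = q * w n" for w n
  proof -
    have "?inv w n * p n powr (1 / q - 1) = q * w n * (p n powr (1 / q - 1) * ?x n powr (q - 1))"
      by (simp only: mult_ac)
    then show ?thesis
      by (simp only: cancel mult_1_right)
  qed
  show ?thesis
  proof (rule bij_betw_byWitness[where f' = ?inv])
    show "\<forall>v\<in>simplex_tangent q p. ?inv (d_root q p v) = v"
      by (simp only: inv1) simp
    show "\<forall>w\<in>sphere_tangent q ?x. d_root q p (?inv w) = w"
      unfolding d_root_def inv2 using q by simp
    show "d_root q p ` simplex_tangent q p \<subseteq> sphere_tangent q ?x"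
      using d_root_in_sphere_tangent[OF q p] by blast
    show "?inv ` sphere_tangent q ?x \<subseteq> simplex_tangent q p"
    proof clarify
      fix w assume w: "w \<in> sphere_tangent q ?x"
      then have wl: "w \<in> lq q"
        by (auto simp: sphere_tangent_def lq_has_velocity_def)
      have s: "summable (\<lambda>n. ?x n powr (q - 1) * \<bar>w n\<bar>)"
        using summable_powr_mult[OF q _ x(2) wl] x(1) by (simp add: lq_sphere_def)
      have l: "(\<lambda>n. ?x n powr (q - 1) * w n) \<in> lq 1"
        using s by (simp add: lq_1_iff abs_mult)
      have "(\<Sum>n. ?inv w n) = 0"
        using suminf_mult[OF lq_1_summable[OF l], of q] sphere_tangent_orthogonal[OF q x w] by simp
      moreover have "(\<lambda>n. ?inv w n * p n powr (1 / q - 1)) \<in> lq q"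
        unfolding inv2 using lq_scale[OF wl] q by simp
      ultimately show "?inv w \<in> simplex_tangent q p"
        unfolding simplex_tangent_def using lq_scale[OF l, of q] by simp
    qed
  qed
qed

section \<open>Comparison of the norms\<close>

text \<open>The factor \<open>q\<close> cancels the \<open>1 / q\<close> in \<open>d_root\<close>.
  As \<open>p powr (1 / q - 1)\<close> is \<open>p powr (1 / q) / p\<close>, the \<open>q\<close>-th
  powers then agree in each coordinate.\<close>

lemma lq_norm_d_root:
  assumes q: "1 < q" and p: "p \<in> simplex" and v: "v \<in> simplex_tangent q p"
  shows "q * lq_norm q (d_root q p v) = fisher_rao q p v"
proof -
  have eq: "q powr q * \<bar>d_root q p v n\<bar> powr q = \<bar>v n / p n\<bar> powr q * p n" for n
  proof -
    have "q powr q * \<bar>d_root q p v n\<bar> powr q = (q * \<bar>d_root q p v n\<bar>) powr q"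
      using q by (simp add: powr_mult)
    also have "q * \<bar>d_root q p v n\<bar> = \<bar>v n / p n\<bar> * p n powr (1 / q)"
      using q simplexD(3)[OF p, of n] by (simp add: d_root_def abs_mult abs_divide powr_diff)
    also have "(\<bar>v n / p n\<bar> * p n powr (1 / q)) powr q = \<bar>v n / p n\<bar> powr q * (p n powr (1 / q)) powr q"
      by (simp only: powr_mult abs_ge_zero powr_ge_zero)
    also have "(p n powr (1 / q)) powr q = p n"
      using q simplexD(3)[OF p, of n] by (simp add: powr_powr)
    finally show ?thesis .
  qed
  have "(\<lambda>n. \<bar>d_root q p v n\<bar> powr q) sums (lq_norm q (d_root q p v) powr q)"
  proof -
    have "d_root q p v \<in> lq q"
      using lq_scale[of "\<lambda>n. v n * p n powr (1 / q - 1)" q "1 / q"] v q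
      by (simp add: simplex_tangent_def d_root_def)
    then show ?thesis
      using lq_norm_powr[of q] q by (simp add: lq_def sums_iff)
  qed
  from sums_mult[OF this, of "q powr q"]
  have "(\<Sum>n. \<bar>v n / p n\<bar> powr q * p n) = q powr q * lq_norm q (d_root q p v) powr q"
    by (simp only: eq sums_iff)
  moreover have "0 \<le> lq_norm q (d_root q p v)"
    by (simp add: lq_norm_def)
  ultimately show ?thesis
    using q by (simp add: fisher_rao_def powr_mult powr_powr)
qed

section \<open>The diffeomorphism property\<close>

text \<open>The local extension is the identity on all of \<open>lq q\<close>, which is its own
  derivative at every point.\<close>

lemma lq_C1_on_identity:
  assumes q: "0 < q" and X: "X \<subseteq> lq q" and g: "\<And>x. x \<in> X \<Longrightarrow> g x = x"
  shows "lq_C1_on q g X"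
proof -
  have zero: "lq_norm q (\<lambda>n. 0) = 0"
    by (simp add: lq_norm_def)
  have "lq_bounded_linear q (\<lambda>z. z)"
    unfolding lq_bounded_linear_def by (auto intro!: exI[of _ 1])
  then have "lq_frechet q (\<lambda>z. z) (\<lambda>z. z) x" for x
    unfolding lq_frechet_def by (auto simp: zero lq_norm_def intro!: exI[of _ 1])
  then have "lq_C1_open q (\<lambda>z. z) (lq q)"
    unfolding lq_C1_open_def
    by (auto simp: lq_open_def zero lq_norm_def intro!: exI[of _ "\<lambda>_ z. z"] exI[of _ "1::real"])
  then show ?thesis
    unfolding lq_C1_on_def using X g by (metis IntE subsetD)
qed

text \<open>The factor \<open>k\<close> is arbitrary because \<open>rescale\<close> changes only the
  Finsler norm, not the points or the chart.\<close>

lemma diffeomorphism_root_transform: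
  assumes q: "0 < q"
  shows "diffeomorphism q (Delta q) (rescale k (positive_sphere q)) (root_transform q)"
proof -
  let ?U = "{x \<in> lq_sphere q. \<forall>n. 0 < x n}"
  have bij: "bij_betw (root_transform q) simplex ?U"
    by (rule bij_betw_root_transform[OF q])
  have img: "root_transform q ` simplex = ?U"
    using bij by (simp add: bij_betw_def)
  have inv: "inv_into simplex (root_transform q) ` ?U \<subseteq> simplex"
    unfolding img[symmetric] by (auto intro: inv_into_into)
  have id: "inv_into ?U (\<lambda>x. x) x = x" if "x \<in> ?U" for x
    using f_inv_into_f[of x "\<lambda>x. x" ?U] that by simp
  have U: "?U \<subseteq> lq q"
    by (auto simp: lq_sphere_def)
  have rinv: "root_transform q (inv_into simplex (root_transform q) x) = x" if "x \<in> ?U" for x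
    using f_inv_into_f[of x "root_transform q" simplex] that img by simp
  show ?thesis
    unfolding diffeomorphism_def C1_map_def Delta_def rescale_def positive_sphere_def
    using bij img inv rinv id U by (auto intro!: lq_C1_on_identity[OF q])
qed

section \<open>Assembly of the isometry\<close>

theorem theorem2p6:
  fixes q :: real
  assumes "1 < q"
  shows "finsler_isometry q (Delta q) (rescale q (positive_sphere q)) (root_transform q)"
  unfolding finsler_isometry_def
proof (intro conjI ballI)
  show "diffeomorphism q (Delta q) (rescale q (positive_sphere q)) (root_transform q)"
    using assms by (intro diffeomorphism_root_transform) simp
next
  fix p assume "p \<in> points (Delta q)"
  then have p: "p \<in> simplex"
    by (simp add: Delta_def)
  have linear: "d_root q p (\<lambda>n. a * v n + b * w n) = (\<lambda>n. a * d_root q p v n + b * d_root q p w n)"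
    for a b v w
    by (simp add: d_root_def distrib_right add_divide_distrib mult.assoc)
  have "has_differential q (Delta q) (rescale q (positive_sphere q)) (root_transform q) p (d_root q p)"
    unfolding has_differential_def
  proof (intro conjI ballI allI impI)
    fix v assume "v \<in> tangent (Delta q) p"
    then have v: "v \<in> simplex_tangent q p"
      by (simp add: Delta_def)
    show "d_root q p v \<in> tangent (rescale q (positive_sphere q)) (root_transform q p)"
      using d_root_in_sphere_tangent[OF assms p v] by (simp add: rescale_def positive_sphere_def)
    show "\<exists>c. curve_through q (Delta q) c p v"
      by (rule simplex_curve_exists[OF assms p v])
  qed (auto simp: linear intro: root_transform_curve_through[OF assms])
  then show "\<exists>L. has_differential q (Delta q) (rescale q (positive_sphere q)) (root_transform q) p L \<and>
      bij_betw L (tangent (Delta q) p) (tangent (rescale q (positive_sphere q)) (root_transform q p)) \<and>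
      (\<forall>v\<in>tangent (Delta q) p. fnorm (rescale q (positive_sphere q)) (root_transform q p) (L v) =
        fnorm (Delta q) p v)"
  proof (intro exI[of _ "d_root q p"] conjI)
    show "bij_betw (d_root q p) (tangent (Delta q) p)
        (tangent (rescale q (positive_sphere q)) (root_transform q p))"
      using bij_betw_d_root[OF assms p] by (simp add: Delta_def rescale_def positive_sphere_def)
    show "\<forall>v\<in>tangent (Delta q) p. fnorm (rescale q (positive_sphere q)) (root_transform q p)
        (d_root q p v) = fnorm (Delta q) p v"
      using lq_norm_d_root[OF assms p] by (simp add: Delta_def rescale_def positive_sphere_def)
  qed
qed

end
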